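(* Let $\sigma$ be a permutation of $\mathbf{N}$ and let $\mathcal{I}, \mathcal{J}$ be admissible ideals on $\mathbf{N}$ such that $\mathcal{J}$ is not maximal. Then the following are equivalent: (P1) $\sigma \in (c(\mathcal{I}), c(\mathcal{J}))$ and $\mathcal{I}\text{-}\lim x=\mathcal{J}\text{-}\lim \sigma(x)$ for all $x \in c(\mathcal{I})$; (P2) $\sigma \in (c(\mathcal{I}), c(\mathcal{J}))$; (P3) $\sigma \in (c_0(\mathcal{I}), c_0(\mathcal{J}))$; (P4) $\sigma \in (c_0(\mathcal{I}), c(\mathcal{J}))$; (P5) $\sigma(\mathcal{I}) \subseteq \mathcal{J}$; (P6) $\sigma$ is $(\mathcal{I},\mathcal{J})$-regular; (P7) $\sigma \in (c_0(\mathcal{I}) \cap \ell_\infty, c_0(\mathcal{J})\cap \ell_\infty)$. In addition, if $\mathcal{I}=\mathcal{Z}_{g}$ and $\mathcal{J}=\mathcal{Z}_{h}$ are two simple density ideals such that $$\forall \alpha>1, \quad \limsup_{n\to \infty} \frac{n}{g(n)}<\infty \quad \text{ and }\quad \limsup_{n\to \infty} \frac{g(\lfloor \alpha n\rfloor)}{h(n)}<\infty,$$ then each of the conditions (P1), (P2), (P3), (P4), (P5), (P6), (P7) is equivalent to: (P8) $0$ is not a $\mathcal{J}$-limit point of the sequence $\widehat{\sigma}$ defined by $\widehat{\sigma}_n:=n/\sigma^{-1}(n)$ for all $n\in\mathbf{N}$.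
   Context: $\mathbf{N}$ is the set of positive integers. An ideal on $\mathbf{N}$ is a family of subsets of $\mathbf{N}$ closed under finite unions and under taking subsets; it is admissible if it contains every finite subset of $\mathbf{N}$ and is not equal to $\mathcal{P}(\mathbf{N})$. An admissible ideal $\mathcal{J}$ is maximal if it is maximal with respect to inclusion among ideals different from $\mathcal{P}(\mathbf{N})$ (equivalently, for each $S\subseteq\mathbf{N}$, either $S\in\mathcal{J}$ or $\mathbf{N}\setminus S\in\mathcal{J}$). Let $\omega$ be the set of all real sequences indexed by $\mathbf{N}$. A sequence $x\in\omega$ is $\mathcal{I}$-convergent to $\eta\in\mathbf{R}$, written $\mathcal{I}\text{-}\lim x=\eta$, if $\{n\in\mathbf{N}: |x_n-\eta|>\varepsilon\}\in\mathcal{I}$ for all $\varepsilon>0$. $c(\mathcal{I})$ is the vector space of all (not necessarily bounded) $\mathcal{I}$-convergent real sequences, $c_0(\mathcal{I})$ its subspace of sequences with $\mathcal{I}$-limit $0$, and $\ell_\infty$ the space of bounded real sequences. For a permutation $\sigma$ of $\mathbf{N}$ and $x\in\omega$, $\sigma(x)$ is the sequence with $\sigma(x)_n:=x_{\sigma^{-1}(n)}$ for all $n$. For $X,Y\subseteq\omega$, $\sigma\in(X,Y)$ means that $\sigma(x)\in Y$ for all $x\in X$. $\sigma$ is $(\mathcal{I},\mathcal{J})$-regular if $\sigma\in(c(\mathcal{I})\cap\ell_\infty,c(\mathcal{J})\cap\ell_\infty)$ and $\mathcal{I}\text{-}\lim x=\mathcal{J}\text{-}\lim\sigma(x)$ for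 all $x\in c(\mathcal{I})\cap\ell_\infty$. (Equivalently, these notions refer to the infinite matrix $A_\sigma=(a_{n,k})$ with $a_{n,k}=1$ if $\sigma^{-1}(n)=k$ and $a_{n,k}=0$ otherwise, acting by $A_\sigma x=\sigma(x)$.) $\sigma(\mathcal{I}):=\{\sigma(S): S\in\mathcal{I}\}$, where $\sigma(S)$ is the image of $S$. A simple density ideal is an ideal of the form $\mathcal{Z}_g:=\{S\subseteq\mathbf{N}: \mathsf{d}^\star_g(S)=0\}$, where $g:\mathbf{N}\to[0,\infty)$ satisfies $\lim_n g(n)=+\infty$ and $n/g(n)$ does not converge to $0$, and $\mathsf{d}^\star_g(S):=\limsup_{n\to\infty}\frac{|S\cap[1,n]|}{g(n)}$. In the second part, $g$ and $h$ are functions of this kind. A real number $\eta$ is a $\mathcal{J}$-limit point of $x\in\omega$ if there is a subsequence $(x_{n_k})_k$ with $\lim_k x_{n_k}=\eta$ and $\{n_k: k\in\mathbf{N}\}\notin\mathcal{J}$. *)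

theory Defs
  imports
    Complex_Main
    "HOL-Library.Liminf_Limsup"
    "HOL-Library.Extended_Real"
    "HOL-Combinatorics.Permutations"
begin

text \<open>
  The paper's index set is the set of positive integers, rendered here as \<open>{1..} :: nat set\<close>.
  A real sequence is a function \<open>nat \<Rightarrow> real\<close> whose value at \<open>0\<close> is never used,
  and a permutation is a function \<open>\<sigma>\<close> with \<open>\<sigma> permutes {1..}\<close>, so that \<open>inv \<sigma>\<close> is
  its inverse.
\<close>

abbreviation Npos :: "nat set" where
  "Npos \<equiv> {1..}"

definition is_ideal :: "nat set set \<Rightarrow> bool" where
  "is_ideal I \<longleftrightarrow> I \<subseteq> Pow Npos \<and> {} \<in> I \<and>
     (\<forall>A\<in>I. \<forall>B\<in>I. A \<union> B \<in> I) \<and> (\<forall>A\<in>I. \<forall>B. B \<subseteq> A \<longrightarrow> B \<in> I)"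

definition admissible :: "nat set set \<Rightarrow> bool" where
  "admissible I \<longleftrightarrow> is_ideal I \<and> (\<forall>F. finite F \<and> F \<subseteq> Npos \<longrightarrow> F \<in> I) \<and> I \<noteq> Pow Npos"

definition maximal_ideal :: "nat set set \<Rightarrow> bool" where
  "maximal_ideal J \<longleftrightarrow> admissible J \<and>
     (\<forall>K. is_ideal K \<and> K \<noteq> Pow Npos \<and> J \<subseteq> K \<longrightarrow> K = J)"

definition ideal_converges_to :: "nat set set \<Rightarrow> (nat \<Rightarrow> real) \<Rightarrow> real \<Rightarrow> bool" where
  "ideal_converges_to I x \<eta> \<longleftrightarrow> (\<forall>\<epsilon>>0. {n \<in> Npos. \<bar>x n - \<eta>\<bar> > \<epsilon>} \<in> I)"

lemma ideal_converges_to_unique: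
  assumes "admissible I" "ideal_converges_to I x a" "ideal_converges_to I x b"
  shows "a = b"
proof (rule ccontr)
  assume "a \<noteq> b"
  define \<epsilon> where "\<epsilon> = \<bar>a - b\<bar> / 3"
  define A where "A = {n \<in> Npos. \<bar>x n - a\<bar> > \<epsilon>}"
  define B where "B = {n \<in> Npos. \<bar>x n - b\<bar> > \<epsilon>}"
  have "\<epsilon> > 0" and sep: "\<bar>a - b\<bar> = 3 * \<epsilon>"
    using \<open>a \<noteq> b\<close> by (simp_all add: \<epsilon>_def)
  have "A \<in> I" "B \<in> I"
    using assms(2,3) \<open>\<epsilon> > 0\<close> by (simp_all add: ideal_converges_to_def A_def B_def)
  moreover have I: "is_ideal I \<and> I \<noteq> Pow Npos"
    using assms(1) unfolding admissible_def by blast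
  ultimately have "A \<union> B \<in> I"
    unfolding is_ideal_def by blast
  moreover have "A \<union> B = Npos"
  proof -
    have "\<bar>x n - a\<bar> > \<epsilon> \<or> \<bar>x n - b\<bar> > \<epsilon>" for n
      using \<open>\<epsilon> > 0\<close> sep by linarith
    then show ?thesis
      unfolding A_def B_def by blast
  qed
  ultimately have "Npos \<in> I"
    by (simp only:)
  then have "Pow Npos \<subseteq> I"
    using I unfolding is_ideal_def by blast
  moreover have "I \<subseteq> Pow Npos"
    using I unfolding is_ideal_def by blast
  ultimately show False
    using I by blast
qed

text \<open>Meaningful for ideal-convergent sequences, by \<open>ideal_converges_to_unique\<close>.\<close>

definition ideal_lim :: "nat set set \<Rightarrow> (nat \<Rightarrow> real) \<Rightarrow> real" where
  "ideal_lim I x = (THE \<eta>. ideal_converges_to I x \<eta>)"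

definition c_ideal :: "nat set set \<Rightarrow> (nat \<Rightarrow> real) set" where
  "c_ideal I = {x. \<exists>\<eta>. ideal_converges_to I x \<eta>}"

definition c0_ideal :: "nat set set \<Rightarrow> (nat \<Rightarrow> real) set" where
  "c0_ideal I = {x. ideal_converges_to I x 0}"

definition l_infty :: "(nat \<Rightarrow> real) set" where
  "l_infty = {x. \<exists>M. \<forall>n\<in>Npos. \<bar>x n\<bar> \<le> M}"

definition perm_seq :: "(nat \<Rightarrow> nat) \<Rightarrow> (nat \<Rightarrow> real) \<Rightarrow> nat \<Rightarrow> real" where
  "perm_seq \<sigma> x = (\<lambda>n. x (inv \<sigma> n))"

definition maps_into :: "(nat \<Rightarrow> nat) \<Rightarrow> (nat \<Rightarrow> real) set \<Rightarrow> (nat \<Rightarrow> real) set \<Rightarrow> bool" where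
  "maps_into \<sigma> X Y \<longleftrightarrow> (\<forall>x\<in>X. perm_seq \<sigma> x \<in> Y)"

definition ideal_regular :: "nat set set \<Rightarrow> nat set set \<Rightarrow> (nat \<Rightarrow> nat) \<Rightarrow> bool" where
  "ideal_regular I J \<sigma> \<longleftrightarrow>
     maps_into \<sigma> (c_ideal I \<inter> l_infty) (c_ideal J \<inter> l_infty) \<and>
     (\<forall>x \<in> c_ideal I \<inter> l_infty. ideal_lim I x = ideal_lim J (perm_seq \<sigma> x))"

definition image_ideal :: "(nat \<Rightarrow> nat) \<Rightarrow> nat set set \<Rightarrow> nat set set" where
  "image_ideal \<sigma> I = {\<sigma> ` S | S. S \<in> I}"

definition density_function :: "(nat \<Rightarrow> real) \<Rightarrow> bool" where
  "density_function g \<longleftrightarrow> (\<forall>n\<in>Npos. 0 \<le> g n) \<and> filterlim g at_top sequentially \<and>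
     \<not> (\<lambda>n. real n / g n) \<longlonglongrightarrow> 0"

text \<open>
  As \<open>g\<close> tends to infinity, \<open>g n = 0\<close> occurs for only finitely many \<open>n\<close>, so the
  convention \<open>x / 0 = 0\<close> does not affect the limits superior below, which are taken in the
  extended reals.
\<close>

definition upper_density :: "(nat \<Rightarrow> real) \<Rightarrow> nat set \<Rightarrow> ereal" where
  "upper_density g S = limsup (\<lambda>n. ereal (real (card (S \<inter> {1..n})) / g n))"

definition simple_density_ideal :: "(nat \<Rightarrow> real) \<Rightarrow> nat set set" where
  "simple_density_ideal g = {S. S \<subseteq> Npos \<and> upper_density g S = 0}"

definition ideal_limit_point :: "nat set set \<Rightarrow> (nat \<Rightarrow> real) \<Rightarrow> real \<Rightarrow> bool" where
  "ideal_limit_point J x \<eta> \<longleftrightarrow>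
     (\<exists>k :: nat \<Rightarrow> nat. strict_mono k \<and> range k \<subseteq> Npos \<and>
        (\<lambda>i. x (k i)) \<longlonglongrightarrow> \<eta> \<and> range k \<notin> J)"

definition sigma_hat :: "(nat \<Rightarrow> nat) \<Rightarrow> nat \<Rightarrow> real" where
  "sigma_hat \<sigma> n = real n / real (inv \<sigma> n)"

end

theory Submission
  imports Defs "HOL-Library.Infinite_Set" "HOL-Library.Indicator_Function"
begin

text \<open>
  All seven conditions reduce to \<open>\<sigma>(\<I>) \<subseteq> \<J>\<close>. The delicate one is the fourth: if some
  \<open>T = \<sigma>(S)\<close> with \<open>S \<in> \<I>\<close> were outside \<open>\<J>\<close>, then the indicator of every subset of \<open>T\<close> would
  be \<open>\<J>\<close>-convergent, so every subset of \<open>T\<close> or its complement would be in \<open>\<J>\<close>, and this forces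
  \<open>\<J>\<close> to be maximal.

  For density ideals, the set of \<open>m \<in> T\<close> with \<open>\<sigma>\<inverse>(m) \<le> j m\<close> is in \<open>\<Z>\<^sub>h\<close> for every \<open>j\<close>, because
  \<open>g(jn) = O(h(n))\<close>. Removing these sets and diagonalising over \<open>j\<close> leaves a set outside
  \<open>\<Z>\<^sub>h\<close> along which \<open>m / \<sigma>\<inverse>(m)\<close> tends to zero. Conversely, if \<open>m / \<sigma>\<inverse>(m)\<close> tends to zero along
  \<open>K\<close>, then \<open>\<sigma>\<inverse>(K)\<close> has at most \<open>\<epsilon> n + O(1)\<close> elements up to \<open>n\<close>, so it is in
  \<open>\<Z>\<^sub>g\<close>, because \<open>n = O(g(n))\<close>.
\<close>

section \<open>Ideal convergence under permutations\<close>

lemma is_ideal_subset: "is_ideal I \<Longrightarrow> A \<in> I \<Longrightarrow> B \<subseteq> A \<Longrightarrow> B \<in> I"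
  by (simp add: is_ideal_def)

lemma is_ideal_Un: "is_ideal I \<Longrightarrow> A \<in> I \<Longrightarrow> B \<in> I \<Longrightarrow> A \<union> B \<in> I"
  by (simp add: is_ideal_def)

lemma is_ideal_Npos: "is_ideal I \<Longrightarrow> A \<in> I \<Longrightarrow> A \<subseteq> Npos"
  unfolding is_ideal_def by (elim conjE) (rule PowD, rule subsetD)

lemma admissible_is_ideal: "admissible I \<Longrightarrow> is_ideal I"
  by (simp add: admissible_def)

lemma ideal_lim_eqI:
  assumes "admissible I" "ideal_converges_to I x \<eta>"
  shows "ideal_lim I x = \<eta>"
  unfolding ideal_lim_def
  using assms(2) ideal_converges_to_unique[OF assms(1) _ assms(2)] by (rule the_equality)

text \<open>A set in \<open>K\<close> but not in \<open>J\<close> would have its complement in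
  \<open>J\<close>, hence in \<open>K\<close>, and then \<open>K\<close> would contain all of
  \<open>Npos\<close>.\<close>

lemma maximal_idealI:
  assumes J: "admissible J" and dich: "\<And>B. B \<subseteq> Npos \<Longrightarrow> B \<in> J \<or> Npos - B \<in> J"
  shows "maximal_ideal J"
  unfolding maximal_ideal_def
proof (intro conjI allI impI J)
  fix K assume K: "is_ideal K \<and> K \<noteq> Pow Npos \<and> J \<subseteq> K"
  have "B \<in> J" if B: "B \<in> K" for B
  proof (rule ccontr)
    assume "B \<notin> J"
    have BN: "B \<subseteq> Npos"
      using K B is_ideal_Npos by blast
    then have "Npos - B \<in> K"
      using dich \<open>B \<notin> J\<close> K by blast
    then have "B \<union> (Npos - B) \<in> K"
      using K B is_ideal_Un by blast
    moreover have "B \<union> (Npos - B) = Npos"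
      using BN by blast
    ultimately have "Npos \<in> K"
      by metis
    then have "Pow Npos \<subseteq> K"
      using K is_ideal_subset by blast
    moreover have "K \<subseteq> Pow Npos"
      using K is_ideal_Npos by blast
    ultimately show False
      using K by blast
  qed
  then show "K = J"
    using K by blast
qed

section \<open>Indicators and level sets under a permutation\<close>

lemma perm_seq_indicator:
  assumes "\<sigma> permutes A"
  shows "perm_seq \<sigma> (indicator S) = indicator (\<sigma> ` S)"
proof
  fix n
  have "inv \<sigma> n \<in> S \<longleftrightarrow> n \<in> \<sigma> ` S"
    using permutes_inverses[OF assms] by (metis image_iff)
  then show "perm_seq \<sigma> (indicator S) n = indicator (\<sigma> ` S) n"
    unfolding perm_seq_def indicator_def by (rule arg_cong)
qed

text \<open>Every level set lies inside \<open>S\<close>, and the one at threshold 1/2 is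
  \<open>S\<close> itself. This lets conditions on sequences be tested on members of the
  ideal.\<close>

lemma indicator_converges_to_0_iff:
  assumes "is_ideal I" "S \<subseteq> Npos"
  shows "ideal_converges_to I (indicator S) 0 \<longleftrightarrow> S \<in> I"
proof
  assume "ideal_converges_to I (indicator S) 0"
  then have "{n \<in> Npos. \<bar>indicator S n - 0 :: real\<bar> > 1/2} \<in> I"
    unfolding ideal_converges_to_def by (metis half_gt_zero zero_less_one)
  then show "S \<in> I"
    by (rule is_ideal_subset[OF assms(1)]) (use assms(2) in auto)
next
  assume S: "S \<in> I"
  show "ideal_converges_to I (indicator S) 0"
    unfolding ideal_converges_to_def
  proof (intro allI impI)
    fix \<epsilon> :: real assume "\<epsilon> > 0"
    then have "{n \<in> Npos. \<bar>indicator S n - 0\<bar> > \<epsilon>} \<subseteq> S"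
      by (intro subsetI) (rule ccontr, simp)
    then show "{n \<in> Npos. \<bar>indicator S n - 0\<bar> > \<epsilon>} \<in> I"
      by (rule is_ideal_subset[OF assms(1) S])
  qed
qed

text \<open>No real \<open>\<eta>\<close> is within 1/4 of both 0 and 1. So the exceptional set at
  threshold 1/4 contains the points outside \<open>S\<close> if \<open>\<eta> > 1/2\<close>, and the
  points of \<open>S\<close> otherwise.\<close>

lemma indicator_converges_dichotomy:
  assumes J: "is_ideal J" and "S \<subseteq> Npos" and "ideal_converges_to J (indicator S) \<eta>"
  shows "S \<in> J \<or> Npos - S \<in> J"
proof -
  have *: "{n \<in> Npos. \<bar>indicator S n - \<eta>\<bar> > 1/4} \<in> J"
    using assms(3) unfolding ideal_converges_to_def
    by (meson divide_pos_pos zero_less_numeral zero_less_one)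
  show ?thesis
  proof (cases "\<eta> > 1/2")
    case True
    then have "Npos - S \<in> J"
      by (intro is_ideal_subset[OF J *]) auto
    then show ?thesis ..
  next
    case False
    then have "S \<in> J"
      using assms(2) by (intro is_ideal_subset[OF J *]) auto
    then show ?thesis ..
  qed
qed

lemma perm_seq_level_set:
  assumes "\<sigma> permutes A"
  shows "{n \<in> A. P (perm_seq \<sigma> x n)} = \<sigma> ` {n \<in> A. P (x n)}"
proof (intro equalityI subsetI)
  fix n assume "n \<in> {n \<in> A. P (perm_seq \<sigma> x n)}"
  then have "inv \<sigma> n \<in> {n \<in> A. P (x n)}"
    using permutes_in_image[OF permutes_inv[OF assms]] by (simp add: perm_seq_def)
  then show "n \<in> \<sigma> ` {n \<in> A. P (x n)}"
    by (rule image_eqI[rotated]) (simp add: permutes_inverses(1)[OF assms])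
next
  fix n assume "n \<in> \<sigma> ` {n \<in> A. P (x n)}"
  then show "n \<in> {n \<in> A. P (perm_seq \<sigma> x n)}"
    using permutes_in_image[OF assms] permutes_inverses(2)[OF assms]
    by (auto simp: perm_seq_def)
qed

text \<open>Level sets of the permuted sequence are \<open>\<sigma>\<close>-images of level sets of
  \<open>x\<close>. The limit is preserved, so this one fact serves all the sequence conditions
  derived from (P5).\<close>

lemma perm_seq_converges:
  assumes "\<sigma> permutes Npos" "image_ideal \<sigma> I \<subseteq> J" "ideal_converges_to I x \<eta>"
  shows "ideal_converges_to J (perm_seq \<sigma> x) \<eta>"
  unfolding ideal_converges_to_def
proof (intro allI impI)
  fix \<epsilon> :: real assume "\<epsilon> > 0"
  then have "\<sigma> ` {n \<in> Npos. \<bar>x n - \<eta>\<bar> > \<epsilon>} \<in> J"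
    using assms(2,3) unfolding ideal_converges_to_def image_ideal_def by blast
  then show "{n \<in> Npos. \<bar>perm_seq \<sigma> x n - \<eta>\<bar> > \<epsilon>} \<in> J"
    using perm_seq_level_set[OF assms(1), of "\<lambda>y. \<bar>y - \<eta>\<bar> > \<epsilon>" x] by simp
qed

lemma perm_seq_l_infty:
  assumes "\<sigma> permutes Npos" "x \<in> l_infty"
  shows "perm_seq \<sigma> x \<in> l_infty"
proof -
  obtain M where "\<forall>n\<in>Npos. \<bar>x n\<bar> \<le> M"
    using assms(2) by (auto simp: l_infty_def)
  then have "\<forall>n\<in>Npos. \<bar>perm_seq \<sigma> x n\<bar> \<le> M"
    using permutes_in_image[OF permutes_inv[OF assms(1)]] by (simp add: perm_seq_def)
  then show ?thesis
    by (auto simp: l_infty_def)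
qed

lemma indicator_l_infty: "indicator S \<in> l_infty"
  unfolding l_infty_def mem_Collect_eq by (rule exI[of _ 1]) (simp add: indicator_def)

text \<open>The limit of the permuted sequence is not prescribed here, so indicators only yield a
  dichotomy; non-maximality of \<open>J\<close> then excludes the bad case.\<close>

lemma image_ideal_subset_if_c0_to_c:
  assumes \<sigma>: "\<sigma> permutes Npos" and I: "is_ideal I" and J: "admissible J"
    and nmax: "\<not> maximal_ideal J" and maps: "maps_into \<sigma> (c0_ideal I) (c_ideal J)"
  shows "image_ideal \<sigma> I \<subseteq> J"
proof (rule ccontr)
  note Ji = admissible_is_ideal[OF J]
  assume "\<not> image_ideal \<sigma> I \<subseteq> J"
  then obtain S where S: "S \<in> I" "\<sigma> ` S \<notin> J"
    by (auto simp: image_ideal_def)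
  \<comment> \<open>Since \<open>I\<close> is closed under subsets, the dichotomy holds for every
    part of \<open>S\<close>, not only for \<open>S\<close>.\<close>
  have dich: "\<sigma> ` A \<in> J \<or> Npos - \<sigma> ` A \<in> J" if "A \<subseteq> S" for A
  proof -
    have A: "A \<in> I"
      using is_ideal_subset[OF I] S(1) that by blast
    then have AN: "A \<subseteq> Npos"
      using is_ideal_Npos[OF I] by blast
    have "indicator A \<in> c0_ideal I"
      using indicator_converges_to_0_iff[OF I AN] A by (simp add: c0_ideal_def)
    then have "perm_seq \<sigma> (indicator A) \<in> c_ideal J"
      using maps unfolding maps_into_def by blast
    then have "indicator (\<sigma> ` A) \<in> c_ideal J"
      by (simp only: perm_seq_indicator[OF \<sigma>])
    moreover have "\<sigma> ` A \<subseteq> Npos"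
      using AN permutes_image[OF \<sigma>] by blast
    ultimately show ?thesis
      using indicator_converges_dichotomy[OF Ji] by (auto simp: c_ideal_def)
  qed
  have co: "Npos - \<sigma> ` S \<in> J"
    using dich S by blast
  have "maximal_ideal J"
  proof (rule maximal_idealI[OF J])
    fix B assume B: "B \<subseteq> Npos"
    \<comment> \<open>An arbitrary \<open>B\<close> is decided by its trace on
      \<open>\<sigma>\<close>
      S\<open>: the remainder of\<close>B\<open>lies in the complement of\<close>\<sigma>
      \<open>S\<close>, which is in \<open>J\<close> by \<open>co\<close>.\<close>
    obtain A where A: "A \<subseteq> S" "\<sigma> ` A = B \<inter> \<sigma> ` S"
      by (metis Int_lower2 subset_image_iff)
    show "B \<in> J \<or> Npos - B \<in> J"
      using dich[OF A(1)]
    proof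
      assume "\<sigma> ` A \<in> J"
      then have "\<sigma> ` A \<union> (Npos - \<sigma> ` S) \<in> J"
        using co is_ideal_Un[OF Ji] by blast
      moreover have "B \<subseteq> \<sigma> ` A \<union> (Npos - \<sigma> ` S)"
        using A(2) B by blast
      ultimately show ?thesis
        using is_ideal_subset[OF Ji] by blast
    next
      assume "Npos - \<sigma> ` A \<in> J"
      moreover have "Npos - B \<subseteq> Npos - \<sigma> ` A"
        using A(2) by blast
      ultimately show ?thesis
        using is_ideal_subset[OF Ji] by blast
    qed
  qed
  then show False
    using nmax by blast
qed

text \<open>Common core of the passages from (P6) and (P7) to (P5): once the limit 0 is known for
  the permuted indicator, membership of the image in \<open>J\<close> can be read off
  directly.\<close>

lemma image_ideal_subset_if_indicators_null:
  assumes \<sigma>: "\<sigma> permutes Npos" and I: "is_ideal I" and J: "is_ideal J"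
    and null: "\<And>S. S \<in> I \<Longrightarrow> indicator S \<in> c0_ideal I \<inter> l_infty \<Longrightarrow>
      ideal_converges_to J (perm_seq \<sigma> (indicator S)) 0"
  shows "image_ideal \<sigma> I \<subseteq> J"
proof -
  have "\<sigma> ` S \<in> J" if S: "S \<in> I" for S
  proof -
    have SN: "S \<subseteq> Npos" "\<sigma> ` S \<subseteq> Npos"
      using is_ideal_Npos[OF I S] permutes_image[OF \<sigma>] by blast+
    have "indicator S \<in> c0_ideal I \<inter> l_infty"
      using indicator_converges_to_0_iff[OF I SN(1)] S indicator_l_infty by (simp add: c0_ideal_def)
    then have "ideal_converges_to J (indicator (\<sigma> ` S)) 0"
      using null[OF S] by (simp only: perm_seq_indicator[OF \<sigma>])
    then show ?thesis
      using indicator_converges_to_0_iff[OF J SN(2)] by blast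
  qed
  then show ?thesis
    by (auto simp: image_ideal_def)
qed

section \<open>Simple density ideals\<close>

text \<open>The quotients are eventually nonnegative because \<open>g\<close> is eventually
  positive, so a zero limit superior forces a zero limit inferior. Later arguments can then use
  ordinary real limits.\<close>

lemma simple_density_ideal_iff:
  assumes g: "filterlim g at_top sequentially"
  shows "S \<in> simple_density_ideal g \<longleftrightarrow>
    S \<subseteq> Npos \<and> (\<lambda>n. real (card (S \<inter> {1..n})) / g n) \<longlonglongrightarrow> 0"
proof -
  let ?f = "\<lambda>n. real (card (S \<inter> {1..n})) / g n"
  have "eventually (\<lambda>n. g n > 0) sequentially"
    using g by (simp add: filterlim_at_top_dense)
  then have "eventually (\<lambda>n. ereal 0 \<le> ereal (?f n)) sequentially"
    by eventually_elim simp
  then have nonneg: "0 \<le> liminf (\<lambda>n. ereal (?f n))"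
    by (intro Liminf_bounded) (simp add: zero_ereal_def)
  have "limsup (\<lambda>n. ereal (?f n)) = 0 \<longleftrightarrow> (\<lambda>n. ereal (?f n)) \<longlonglongrightarrow> 0"
  proof
    assume *: "limsup (\<lambda>n. ereal (?f n)) = 0"
    moreover have "liminf (\<lambda>n. ereal (?f n)) \<le> limsup (\<lambda>n. ereal (?f n))"
      by (rule Liminf_le_Limsup) simp
    ultimately show "(\<lambda>n. ereal (?f n)) \<longlonglongrightarrow> 0"
      using nonneg by (intro Liminf_eq_Limsup) auto
  next
    assume "(\<lambda>n. ereal (?f n)) \<longlonglongrightarrow> 0"
    then show "limsup (\<lambda>n. ereal (?f n)) = 0"
      by (intro lim_imp_Limsup) auto
  qed
  also have "\<dots> \<longleftrightarrow> ?f \<longlonglongrightarrow> 0"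
    by (simp add: zero_ereal_def)
  finally show ?thesis
    by (simp add: simple_density_ideal_def upper_density_def)
qed

lemma limsup_finite_imp_bounded:
  assumes "limsup (\<lambda>n. ereal (f n)) < \<infinity>"
  obtains C where "C > 0" "eventually (\<lambda>n. f n \<le> C) sequentially"
proof -
  obtain c where c: "limsup (\<lambda>n. ereal (f n)) < ereal c"
    using assms by (metis ereal_dense2)
  then have "eventually (\<lambda>n. ereal (f n) < ereal c) sequentially"
    by (rule Limsup_lessD)
  \<comment> \<open>The maximum with 1 makes the constant positive, so that it may be divided
    by.\<close>
  then have "eventually (\<lambda>n. f n \<le> max c 1) sequentially"
    by eventually_elim (simp add: le_max_iff_disj less_imp_le)
  then show thesis
    using that[of "max c 1"] by simp
qed

text \<open>The counts stay below \<open>card F\<close> while \<open>g\<close> diverges. The use is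
  that a set outside the ideal is infinite and can be enumerated.\<close>

lemma finite_in_simple_density_ideal:
  assumes "filterlim g at_top sequentially" "finite F" "F \<subseteq> Npos"
  shows "F \<in> simple_density_ideal g"
proof -
  have "(\<lambda>n. real (card (F \<inter> {1..n})) / g n) \<longlonglongrightarrow> 0"
  proof (rule tendsto_0_le[where K = 1])
    show "(\<lambda>n. real (card F) / g n) \<longlonglongrightarrow> 0"
      using assms(1)
      by (intro tendsto_divide_0[OF tendsto_const] filterlim_at_top_imp_at_infinity)
    show "eventually (\<lambda>n. norm (real (card (F \<inter> {1..n})) / g n)
        \<le> norm (real (card F) / g n) * 1) sequentially"
      using assms(2) by (intro always_eventually allI)
        (auto simp: abs_divide intro!: divide_right_mono card_mono)
  qed
  then show ?thesis
    using assms by (simp add: simple_density_ideal_iff)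
qed

text \<open>Dropping an initial segment of \<open>B j\<close> costs a bounded number of points,
  negligible against \<open>h\<close>, so beyond any \<open>N\<close> some block of
  \<open>B j\<close> still has ratio at least \<open>e / 2\<close>. Consecutive blocks taken from
  \<open>B 0\<close>, \<open>B 1\<close>, and so on are glued; \<open>e\<close> must not depend on
  \<open>j\<close>.\<close>

lemma density_diagonal:
  fixes B :: "nat \<Rightarrow> nat set"
  assumes h: "filterlim h at_top sequentially" and dec: "decseq B" and e: "e > 0"
    and large: "\<And>j. frequently (\<lambda>n. real (card (B j \<inter> {1..n})) / h n \<ge> e) sequentially"
  obtains K where "K \<subseteq> B 0" "K \<notin> simple_density_ideal h" "\<forall>j. finite (K - B j)"
proof -
  have "\<exists>n. N < n \<and> real (card (B j \<inter> {N<..n})) / h n \<ge> e / 2" for N j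
  proof -
    \<comment> \<open>The middle condition makes the \<open>N\<close> dropped points fewer than half
      of \<open>e * h n\<close>.\<close>
    have "eventually (\<lambda>n. h n > 0 \<and> h n > 2 * real N / e \<and> n > N) sequentially"
      using h by (intro eventually_conj) (auto simp: filterlim_at_top_dense eventually_gt_at_top)
    from frequently_eventually_frequently[OF large[of j] this]
    obtain n where n: "real (card (B j \<inter> {1..n})) / h n \<ge> e" "h n > 0"
      "h n > 2 * real N / e" "n > N"
      by (auto dest!: frequently_ex)
    have "card (B j \<inter> {1..n}) \<le> card ({1..N} \<union> B j \<inter> {N<..n})"
      by (rule card_mono) auto
    also have "\<dots> \<le> N + card (B j \<inter> {N<..n})"
      using card_Un_le[of "{1..N}" "B j \<inter> {N<..n}"] by simp
    finally have "real (card (B j \<inter> {1..n})) \<le> real N + real (card (B j \<inter> {N<..n}))"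
      by linarith
    moreover have "e * h n \<le> real (card (B j \<inter> {1..n}))"
      using n(1,2) by (simp add: field_simps)
    moreover have "2 * real N < e * h n"
      using n(3) e by (simp add: field_simps)
    ultimately have "e / 2 * h n \<le> real (card (B j \<inter> {N<..n}))"
      by simp
    then show ?thesis
      using n(2,4) by (auto simp: pos_le_divide_eq)
  qed
  \<comment> \<open>\<open>True\<close> fills the slot for a property of single terms in
    \<open>dependent_nat_choice\<close>; the content is the relation between consecutive
    terms.\<close>
  then have "\<exists>N. \<forall>j. True \<and> (N j < N (Suc j) \<and>
      real (card (B j \<inter> {N j<..N (Suc j)})) / h (N (Suc j)) \<ge> e / 2)"
    by (intro dependent_nat_choice) auto
  then obtain N where N: "\<And>j. N j < N (Suc j)"
    and NB: "\<And>j. real (card (B j \<inter> {N j<..N (Suc j)})) / h (N (Suc j)) \<ge> e / 2"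
    by auto
  have mono: "strict_mono N"
    using N by (simp add: strict_mono_Suc_iff)
  define K where "K = (\<Union>j. B j \<inter> {N j<..N (Suc j)})"
  show thesis
  proof
    show "K \<subseteq> B 0"
      using dec by (auto simp: K_def decseq_def)
    show "\<forall>j. finite (K - B j)"
    proof (intro allI, rule finite_subset)
      fix j
      \<comment> \<open>Blocks with index at least \<open>j\<close> lie in \<open>B j\<close> by
        monotonicity, so only the earlier ones, which end by \<open>N j\<close>, can
        contribute.\<close>
      show "K - B j \<subseteq> {..N j}"
      proof
        fix m assume m: "m \<in> K - B j"
        then obtain i where i: "m \<in> B i" "m \<le> N (Suc i)"
          by (auto simp: K_def)
        have "i < j"
        proof (rule ccontr)
          assume "\<not> i < j"
          then have "B i \<subseteq> B j"
            using decseqD[OF dec] by simp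
          then show False
            using m i(1) by blast
        qed
        then have "N (Suc i) \<le> N j"
          using mono by (simp add: strict_mono_less_eq)
        then show "m \<in> {..N j}"
          using i(2) by simp
      qed
    qed simp
    show "K \<notin> simple_density_ideal h"
    proof
      assume "K \<in> simple_density_ideal h"
      then have "(\<lambda>n. real (card (K \<inter> {1..n})) / h n) \<longlonglongrightarrow> 0"
        using simple_density_ideal_iff[OF h] by blast
      moreover have sub: "filterlim (\<lambda>j. N (Suc j)) at_top sequentially"
        using mono by (intro filterlim_subseq) (simp add: strict_mono_def)
      \<comment> \<open>At the block ends the ratio is at least \<open>e / 2\<close>, so the limit
        along this subsequence cannot be 0.\<close>
      ultimately have "(\<lambda>j. real (card (K \<inter> {1..N (Suc j)})) / h (N (Suc j))) \<longlonglongrightarrow> 0"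
        by (rule filterlim_compose)
      then have "eventually (\<lambda>j. real (card (K \<inter> {1..N (Suc j)})) / h (N (Suc j)) < e / 2) sequentially"
        using e by (intro order_tendstoD) auto
      moreover have "eventually (\<lambda>j. h (N (Suc j)) > 0) sequentially"
        using filterlim_compose[OF h sub] by (simp add: filterlim_at_top_dense)
      ultimately have "eventually (\<lambda>j. False) sequentially"
      proof eventually_elim
        case (elim j)
        have "card (B j \<inter> {N j<..N (Suc j)}) \<le> card (K \<inter> {1..N (Suc j)})"
          by (rule card_mono) (auto simp: K_def)
        then have "real (card (B j \<inter> {N j<..N (Suc j)})) / h (N (Suc j))
            \<le> real (card (K \<inter> {1..N (Suc j)})) / h (N (Suc j))"
          using elim(2) by (intro divide_right_mono) auto
        then show ?case
          using NB[of j] elim(1) by linarith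
      qed
      then show False
        by simp
    qed
  qed
qed

text \<open>Up to finitely many indices, \<open>k i < d * inv \<sigma> (k i)\<close>. Hence
  preimages up to \<open>n\<close> come from values \<open>k i\<close> of size at most
  \<open>d * n\<close>, and \<open>n\<close> is at most a constant times \<open>g n\<close>.\<close>

lemma sigma_hat_limit_point_preimage:
  assumes \<sigma>: "\<sigma> permutes Npos" and g: "filterlim g at_top sequentially"
    and lin: "limsup (\<lambda>n. ereal (real n / g n)) < \<infinity>"
    and k: "strict_mono k" "range k \<subseteq> Npos" "(\<lambda>i. sigma_hat \<sigma> (k i)) \<longlonglongrightarrow> 0"
  shows "inv \<sigma> ` range k \<in> simple_density_ideal g"
proof -
  let ?S = "inv \<sigma> ` range k"
  have SN: "?S \<subseteq> Npos"
    using k(2) permutes_image[OF permutes_inv[OF \<sigma>]] by blast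
  obtain C where C: "C > 0" "eventually (\<lambda>n. real n / g n \<le> C) sequentially"
    using limsup_finite_imp_bounded[OF lin] by blast
  have gpos: "eventually (\<lambda>n. g n > 0) sequentially"
    using g by (simp add: filterlim_at_top_dense)
  have "(\<lambda>n. real (card (?S \<inter> {1..n})) / g n) \<longlonglongrightarrow> 0"
  proof (rule LIMSEQ_I, goal_cases)
    case (1 r)
    \<comment> \<open>As \<open>n \<le> C * g n\<close> eventually, \<open>d * n\<close> uses up at
      most half of \<open>r * g n\<close>; the other half absorbs the constant
      \<open>i0\<close>.\<close>
    define d where "d = r / (2 * C)"
    have d: "d > 0" "d * C = r / 2"
      using 1 C(1) by (auto simp: d_def)
    have "eventually (\<lambda>i. sigma_hat \<sigma> (k i) < d) sequentially"
      using k(3) d(1) by (intro order_tendstoD) auto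
    then obtain i0 where i0: "\<And>i. i \<ge> i0 \<Longrightarrow> sigma_hat \<sigma> (k i) < d"
      by (auto simp: eventually_sequentially)
    have bound: "real (card (?S \<inter> {1..n})) \<le> real i0 + d * real n" for n
    proof -
      let ?m = "nat \<lfloor>d * real n\<rfloor>"
      have "?S \<inter> {1..n} \<subseteq> (\<lambda>i. inv \<sigma> (k i)) ` {..<i0} \<union> inv \<sigma> ` {1..?m}"
      proof
        fix s assume "s \<in> ?S \<inter> {1..n}"
        then obtain i where i: "s = inv \<sigma> (k i)" "s \<ge> 1" "s \<le> n"
          by auto
        show "s \<in> (\<lambda>i. inv \<sigma> (k i)) ` {..<i0} \<union> inv \<sigma> ` {1..?m}"
        proof (cases "i < i0")
          case True
          then show ?thesis
            using i(1) by blast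
        next
          case False
          then have "real (k i) / real s < d"
            using i0[of i] i(1) by (simp add: sigma_hat_def)
          then have "real (k i) < d * real s"
            using i(2) by (simp add: field_simps)
          also have "\<dots> \<le> d * real n"
            using i(3) d(1) by simp
          finally have "k i \<le> ?m"
            by (simp add: le_nat_floor)
          moreover have "k i \<ge> 1"
            using k(2) by auto
          ultimately show ?thesis
            using i(1) by auto
        qed
      qed
      then have "card (?S \<inter> {1..n}) \<le> card ((\<lambda>i. inv \<sigma> (k i)) ` {..<i0} \<union> inv \<sigma> ` {1..?m})"
        by (intro card_mono) auto
      also have "\<dots> \<le> card ((\<lambda>i. inv \<sigma> (k i)) ` {..<i0}) + card (inv \<sigma> ` {1..?m})"
        by (rule card_Un_le)
      also have "\<dots> \<le> i0 + ?m"
        using card_image_le[of "{..<i0}" "\<lambda>i. inv \<sigma> (k i)"] card_image_le[of "{1..?m}" "inv \<sigma>"]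
        by simp
      finally have "real (card (?S \<inter> {1..n})) \<le> real i0 + real ?m"
        by linarith
      also have "real ?m \<le> d * real n"
        using d(1) by (intro of_nat_floor) simp
      finally show ?thesis
        by simp
    qed
    have "eventually (\<lambda>n. g n > 2 * real i0 / r) sequentially"
      using g by (simp add: filterlim_at_top_dense)
    then have "eventually (\<lambda>n. norm (real (card (?S \<inter> {1..n})) / g n - 0) < r) sequentially"
      using C(2) gpos
    proof eventually_elim
      case (elim n)
      have "real n \<le> C * g n"
        using elim by (simp add: field_simps)
      then have "d * real n \<le> d * C * g n"
        using d(1) by simp
      then have "d * real n \<le> r / 2 * g n"
        by (simp only: d(2))
      moreover have "real i0 < r / 2 * g n"
        using elim 1 by (simp add: field_simps)
      ultimately have "real (card (?S \<inter> {1..n})) < r * g n"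
        using bound[of n] by simp
      then show ?case
        using elim by (simp add: field_simps)
    qed
    then show ?case
      by (simp add: eventually_sequentially)
  qed
  then show ?thesis
    using SN simple_density_ideal_iff[OF g] by blast
qed

text \<open>If \<open>m \<le> n\<close> and \<open>inv \<sigma> m \<le> j * m\<close>, then the
  preimage of \<open>m\<close> is at most \<open>j * n\<close>. The ratio for the image is thus at
  most the ratio for \<open>S\<close> at \<open>j * n\<close>, which is null, times the bounded
  factor \<open>g (j * n) / h n\<close>.\<close>

lemma image_slow_part_in_density_ideal:
  assumes \<sigma>: "\<sigma> permutes Npos"
    and g: "filterlim g at_top sequentially" and h: "filterlim h at_top sequentially"
    and gh: "limsup (\<lambda>n. ereal (g (j * n) / h n)) < \<infinity>" and j: "j > 0"
    and S: "S \<in> simple_density_ideal g"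
  shows "{m \<in> \<sigma> ` S. inv \<sigma> m \<le> j * m} \<in> simple_density_ideal h"
proof -
  let ?T = "{m \<in> \<sigma> ` S. inv \<sigma> m \<le> j * m}"
  have SN: "S \<subseteq> Npos" and Slim: "(\<lambda>n. real (card (S \<inter> {1..n})) / g n) \<longlonglongrightarrow> 0"
    using S simple_density_ideal_iff[OF g] by blast+
  have TN: "?T \<subseteq> Npos"
    using SN permutes_image[OF \<sigma>] by blast
  obtain C where C: "C > 0" "eventually (\<lambda>n. g (j * n) / h n \<le> C) sequentially"
    using limsup_finite_imp_bounded[OF gh] by blast
  have sub: "filterlim (\<lambda>n. j * n) at_top sequentially"
    using j by (intro filterlim_subseq) (simp add: strict_mono_def)
  have card_le: "card (?T \<inter> {1..n}) \<le> card (S \<inter> {1..j * n})" for n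
  proof -
    have "?T \<inter> {1..n} \<subseteq> \<sigma> ` (S \<inter> {1..j * n})"
    proof
      fix m assume m: "m \<in> ?T \<inter> {1..n}"
      then obtain s where s: "s \<in> S" "m = \<sigma> s"
        by blast
      then have "inv \<sigma> m = s"
        using permutes_inverses(2)[OF \<sigma>] by simp
      then have "s \<le> j * m"
        using m by simp
      also have "\<dots> \<le> j * n"
        using m by simp
      finally show "m \<in> \<sigma> ` (S \<inter> {1..j * n})"
        using s SN by auto
    qed
    then have "card (?T \<inter> {1..n}) \<le> card (\<sigma> ` (S \<inter> {1..j * n}))"
      by (intro card_mono) auto
    also have "\<dots> \<le> card (S \<inter> {1..j * n})"
      by (rule card_image_le) simp
    finally show ?thesis .
  qed
  have "(\<lambda>n. real (card (?T \<inter> {1..n})) / h n) \<longlonglongrightarrow> 0"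
  proof (rule tendsto_0_le[where K = C])
    show "(\<lambda>n. real (card (S \<inter> {1..j * n})) / g (j * n)) \<longlonglongrightarrow> 0"
      using filterlim_compose[OF Slim sub] .
    have "eventually (\<lambda>n. g (j * n) > 0) sequentially"
      using filterlim_compose[OF g sub] by (simp add: filterlim_at_top_dense)
    moreover have "eventually (\<lambda>n. h n > 0) sequentially"
      using h by (simp add: filterlim_at_top_dense)
    ultimately show "eventually (\<lambda>n. norm (real (card (?T \<inter> {1..n})) / h n)
        \<le> norm (real (card (S \<inter> {1..j * n})) / g (j * n)) * C) sequentially"
      using C(2)
    proof eventually_elim
      case (elim n)
      have "real (card (?T \<inter> {1..n})) / h n \<le> real (card (S \<inter> {1..j * n})) / h n"
        using card_le[of n] elim by (intro divide_right_mono) auto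
      also have "\<dots> = real (card (S \<inter> {1..j * n})) / g (j * n) * (g (j * n) / h n)"
        using elim by simp
      also have "\<dots> \<le> real (card (S \<inter> {1..j * n})) / g (j * n) * C"
        using elim by (intro mult_left_mono) auto
      finally show ?case
        using elim by simp
    qed
  qed
  then show ?thesis
    using TN simple_density_ideal_iff[OF h] by blast
qed

lemma sigma_hat_limit_point_exists:
  assumes \<sigma>: "\<sigma> permutes Npos"
    and g: "filterlim g at_top sequentially" and h: "filterlim h at_top sequentially"
    and gh: "\<And>j. j > 1 \<Longrightarrow> limsup (\<lambda>n. ereal (g (j * n) / h n)) < \<infinity>"
    and S: "S \<in> simple_density_ideal g" and T: "\<sigma> ` S \<notin> simple_density_ideal h"
  shows "ideal_limit_point (simple_density_ideal h) (sigma_hat \<sigma>) 0"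
proof -
  have SN: "S \<subseteq> Npos"
    using S simple_density_ideal_iff[OF g] by blast
  have TN: "\<sigma> ` S \<subseteq> Npos"
    using SN permutes_image[OF \<sigma>] by blast
  have hpos: "eventually (\<lambda>n. h n > 0) sequentially"
    using h by (simp add: filterlim_at_top_dense)
  \<comment> \<open>The shift by 2 keeps the multiplier above 1 even for \<open>j = 0\<close>, as
    \<open>gh\<close> requires.\<close>
  define T' where "T' = (\<lambda>j. {m \<in> \<sigma> ` S. inv \<sigma> m \<le> (j + 2) * m})"
  define B where "B = (\<lambda>j. \<sigma> ` S - T' j)"
  have T'lim: "(\<lambda>n. real (card (T' j \<inter> {1..n})) / h n) \<longlonglongrightarrow> 0" for j
    using image_slow_part_in_density_ideal[OF \<sigma> g h gh _ S, of "j + 2"]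
      simple_density_ideal_iff[OF h] by (auto simp: T'_def)
  have "\<not> (\<lambda>n. real (card (\<sigma> ` S \<inter> {1..n})) / h n) \<longlonglongrightarrow> 0"
    using T TN simple_density_ideal_iff[OF h] by blast
  then obtain e where e: "e > 0"
    and "\<not> eventually (\<lambda>n. dist (real (card (\<sigma> ` S \<inter> {1..n})) / h n) 0 < e) sequentially"
    unfolding tendsto_iff by blast
  then have freq: "frequently (\<lambda>n. \<bar>real (card (\<sigma> ` S \<inter> {1..n})) / h n\<bar> \<ge> e) sequentially"
    by (simp add: frequently_def not_le)
  \<comment> \<open>Eventually \<open>T' j\<close> accounts for less than \<open>e / 2\<close>, so
    what remains in \<open>B j\<close> keeps the same bound \<open>e / 2\<close> for every
    \<open>j\<close>.\<close>
  have large: "frequently (\<lambda>n. real (card (B j \<inter> {1..n})) / h n \<ge> e / 2) sequentially" for j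
  proof -
    have "eventually (\<lambda>n. real (card (T' j \<inter> {1..n})) / h n < e / 2) sequentially"
      using T'lim[of j] e by (intro order_tendstoD) auto
    from frequently_eventually_frequently[OF freq eventually_conj[OF this hpos]]
    show ?thesis
    proof (rule frequently_elim1)
      fix n
      assume *: "\<bar>real (card (\<sigma> ` S \<inter> {1..n})) / h n\<bar> \<ge> e \<and>
        real (card (T' j \<inter> {1..n})) / h n < e / 2 \<and> h n > 0"
      have "card (\<sigma> ` S \<inter> {1..n}) \<le> card ((B j \<inter> {1..n}) \<union> (T' j \<inter> {1..n}))"
        by (rule card_mono) (auto simp: B_def)
      also have "\<dots> \<le> card (B j \<inter> {1..n}) + card (T' j \<inter> {1..n})"
        by (rule card_Un_le)
      finally have "real (card (\<sigma> ` S \<inter> {1..n})) / h n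
          \<le> (real (card (B j \<inter> {1..n})) + real (card (T' j \<inter> {1..n}))) / h n"
        using * by (intro divide_right_mono) linarith+
      moreover have "real (card (\<sigma> ` S \<inter> {1..n})) / h n \<ge> e"
        using * by (auto simp: abs_of_pos)
      ultimately show "real (card (B j \<inter> {1..n})) / h n \<ge> e / 2"
        using conjunct1[OF conjunct2[OF *]] unfolding add_divide_distrib by linarith
    qed
  qed
  have dec: "decseq B"
  proof (rule decseq_SucI)
    show "B (Suc j) \<subseteq> B j" for j
      by (auto simp: B_def T'_def)
  qed
  obtain K where K: "K \<subseteq> B 0" "K \<notin> simple_density_ideal h" "\<forall>j. finite (K - B j)"
    using density_diagonal[OF h dec half_gt_zero[OF e] large] .
  have KN: "K \<subseteq> Npos"
    using K(1) TN by (auto simp: B_def)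
  have inf: "infinite K"
    using K(2) KN finite_in_simple_density_ideal[OF h] by blast
  have sm: "strict_mono (enumerate K)"
    using inf by (rule strict_mono_enumerate)
  have "(\<lambda>i. sigma_hat \<sigma> (enumerate K i)) \<longlonglongrightarrow> 0"
  proof (rule LIMSEQ_I, goal_cases)
    case (1 r)
    obtain j :: nat where j: "1 / r < real j"
      using reals_Archimedean2 by blast
    \<comment> \<open>The enumeration is injective, so finitely many exceptional points mean
      finitely many indices. On \<open>B j\<close> the value of \<open>sigma_hat \<sigma>\<close> is
      below \<open>1 / (j + 2)\<close>, hence below \<open>r\<close>.\<close>
    have "finite {i. enumerate K i \<in> K - B j}"
      using finite_vimageI[OF K(3)[rule_format, of j] strict_mono_imp_inj_on[OF sm]] by (simp add: vimage_def)
    then have "eventually (\<lambda>i. enumerate K i \<notin> K - B j) sequentially"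
      by (simp add: cofinite_eq_sequentially[symmetric] eventually_cofinite)
    then have "eventually (\<lambda>i. norm (sigma_hat \<sigma> (enumerate K i) - 0) < r) sequentially"
    proof eventually_elim
      case (elim i)
      let ?m = "enumerate K i"
      have mK: "?m \<in> K"
        using inf by (rule enumerate_in_set)
      then have "?m \<in> B j" "?m \<ge> 1"
        using elim KN by auto
      then have lt: "(j + 2) * ?m < inv \<sigma> ?m"
        by (auto simp: B_def T'_def)
      then have "real ((j + 2) * ?m) < real (inv \<sigma> ?m)"
        by (simp only: of_nat_less_iff)
      moreover have "real ?m \<le> r * real ((j + 2) * ?m)"
      proof -
        have "1 \<le> r * real (j + 2)"
          using j 1 by (simp add: field_simps)
        then have "1 * real ?m \<le> r * real (j + 2) * real ?m"
          by (rule mult_right_mono) simp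
        then show ?thesis
          by (simp only: mult.assoc mult_1_left of_nat_mult)
      qed
      ultimately have "real ?m < r * real (inv \<sigma> ?m)"
        using mult_strict_left_mono[OF _ 1] order_le_less_trans by blast
      then show ?case
        using lt by (simp add: sigma_hat_def field_simps)
    qed
    then show ?case
      by (simp add: eventually_sequentially)
  qed
  then show ?thesis
    unfolding ideal_limit_point_def
    by (intro exI[of _ "enumerate K"]) (simp only: sm range_enumerate[OF inf] KN K(2), simp)
qed

lemma image_density_ideal_subset_iff:
  assumes \<sigma>: "\<sigma> permutes Npos" and g: "density_function g" and h: "density_function h"
    and lin: "limsup (\<lambda>n. ereal (real n / g n)) < \<infinity>"
    and gh: "\<And>\<alpha>::real. \<alpha> > 1 \<Longrightarrow> limsup (\<lambda>n. ereal (g (nat \<lfloor>\<alpha> * real n\<rfloor>) / h n)) < \<infinity>"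
  shows "image_ideal \<sigma> (simple_density_ideal g) \<subseteq> simple_density_ideal h \<longleftrightarrow>
    \<not> ideal_limit_point (simple_density_ideal h) (sigma_hat \<sigma>) 0"
proof
  have g': "filterlim g at_top sequentially" and h': "filterlim h at_top sequentially"
    using g h by (auto simp: density_function_def)
  {
    assume sub: "image_ideal \<sigma> (simple_density_ideal g) \<subseteq> simple_density_ideal h"
    show "\<not> ideal_limit_point (simple_density_ideal h) (sigma_hat \<sigma>) 0"
    proof
      assume "ideal_limit_point (simple_density_ideal h) (sigma_hat \<sigma>) 0"
      then obtain k where k: "strict_mono k" "range k \<subseteq> Npos"
        "(\<lambda>i. sigma_hat \<sigma> (k i)) \<longlonglongrightarrow> 0" "range k \<notin> simple_density_ideal h"
        by (auto simp: ideal_limit_point_def)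
      have "\<sigma> ` inv \<sigma> ` range k \<in> simple_density_ideal h"
        using sigma_hat_limit_point_preimage[OF \<sigma> g' lin k(1-3)] sub
        unfolding image_ideal_def by blast
      \<comment> \<open>The preimage is a member of the first ideal whose image is the witness
        \<open>range k\<close>, which lies outside the second.\<close>
      moreover have "\<sigma> ` inv \<sigma> ` range k = range k"
        by (simp add: image_image permutes_inverses(1)[OF \<sigma>])
      ultimately show False
        using k(4) by metis
    qed
  next
    assume nlp: "\<not> ideal_limit_point (simple_density_ideal h) (sigma_hat \<sigma>) 0"
    have "limsup (\<lambda>n. ereal (g (j * n) / h n)) < \<infinity>" if "j > 1" for j :: nat
    proof -
      \<comment> \<open>At an integer multiplier the floor disappears.\<close>
      have "nat \<lfloor>real j * real n\<rfloor> = j * n" for n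
        by (metis floor_of_nat nat_int of_nat_mult)
      then show ?thesis
        using gh[of "real j"] that by simp
    qed
    then show "image_ideal \<sigma> (simple_density_ideal g) \<subseteq> simple_density_ideal h"
      using sigma_hat_limit_point_exists[OF \<sigma> g' h'] nlp by (auto simp: image_ideal_def)
  }
qed

section \<open>The equivalences\<close>

text \<open>(P5) is the hub: every other condition is shown equivalent to it, and (P8) is compared
  with it alone.\<close>

theorem theorem3p3:
  fixes \<sigma> :: "nat \<Rightarrow> nat" and I J :: "nat set set"
  assumes "\<sigma> permutes Npos"
    and "admissible I"
    and "admissible J"
    and "\<not> maximal_ideal J"
  shows
    "let Ps =
       [maps_into \<sigma> (c_ideal I) (c_ideal J) \<and>
          (\<forall>x \<in> c_ideal I. ideal_lim I x = ideal_lim J (perm_seq \<sigma> x)),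
        maps_into \<sigma> (c_ideal I) (c_ideal J),
        maps_into \<sigma> (c0_ideal I) (c0_ideal J),
        maps_into \<sigma> (c0_ideal I) (c_ideal J),
        image_ideal \<sigma> I \<subseteq> J,
        ideal_regular I J \<sigma>,
        maps_into \<sigma> (c0_ideal I \<inter> l_infty) (c0_ideal J \<inter> l_infty)]
     in (\<forall>P\<in>set Ps. \<forall>Q\<in>set Ps. P \<longleftrightarrow> Q) \<and>
        (\<forall>g h :: nat \<Rightarrow> real.
           density_function g \<and> density_function h \<and>
           I = simple_density_ideal g \<and> J = simple_density_ideal h \<and>
           (\<forall>\<alpha>::real. \<alpha> > 1 \<longrightarrow>
              limsup (\<lambda>n. ereal (real n / g n)) < \<infinity> \<and>
              limsup (\<lambda>n. ereal (g (nat \<lfloor>\<alpha> * real n\<rfloor>) / h n)) < \<infinity>) \<longrightarrow>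
           (\<forall>P\<in>set Ps. P \<longleftrightarrow> \<not> ideal_limit_point J (sigma_hat \<sigma>) 0))"
proof -
  note \<sigma> = assms(1)
  note Ii = admissible_is_ideal[OF assms(2)] and Ji = admissible_is_ideal[OF assms(3)]
  let ?P1 = "maps_into \<sigma> (c_ideal I) (c_ideal J) \<and>
          (\<forall>x \<in> c_ideal I. ideal_lim I x = ideal_lim J (perm_seq \<sigma> x))"
  let ?P2 = "maps_into \<sigma> (c_ideal I) (c_ideal J)"
  let ?P3 = "maps_into \<sigma> (c0_ideal I) (c0_ideal J)"
  let ?P4 = "maps_into \<sigma> (c0_ideal I) (c_ideal J)"
  let ?P5 = "image_ideal \<sigma> I \<subseteq> J"
  let ?P6 = "ideal_regular I J \<sigma>"
  let ?P7 = "maps_into \<sigma> (c0_ideal I \<inter> l_infty) (c0_ideal J \<inter> l_infty)"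
  let ?Ps = "[?P1, ?P2, ?P3, ?P4, ?P5, ?P6, ?P7]"
  have c0_c: "c0_ideal K \<subseteq> c_ideal K" for K
    by (auto simp: c0_ideal_def c_ideal_def)
  have fwd: "?P1 \<and> ?P3 \<and> ?P6 \<and> ?P7" if P5: ?P5
  proof -
    note conv = perm_seq_converges[OF \<sigma> P5] and bdd = perm_seq_l_infty[OF \<sigma>]
    have lim: "ideal_lim I x = ideal_lim J (perm_seq \<sigma> x)" if "x \<in> c_ideal I" for x
      using that conv ideal_lim_eqI[OF assms(2)] ideal_lim_eqI[OF assms(3)]
      by (force simp: c_ideal_def)
    have c: "perm_seq \<sigma> x \<in> c_ideal J" if "x \<in> c_ideal I" for x
      using that conv by (auto simp: c_ideal_def)
    have c0: "perm_seq \<sigma> x \<in> c0_ideal J" if "x \<in> c0_ideal I" for x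
      using that conv by (auto simp: c0_ideal_def)
    show ?thesis
      using lim c c0 bdd by (simp add: maps_into_def ideal_regular_def)
  qed
  have P4_P5: ?P5 if ?P4
    using image_ideal_subset_if_c0_to_c[OF \<sigma> Ii assms(3,4) that] .
  have P2_P4: ?P4 if ?P2
    using that c0_c unfolding maps_into_def by blast
  have P3_P4: ?P4 if ?P3
    using that c0_c unfolding maps_into_def by blast
  \<comment> \<open>Regularity first gives some limit \<open>\<eta>\<close> of the permuted
    indicator; preservation of limits then identifies it as 0.\<close>
  have P6_P5: ?P5 if P6: ?P6
  proof (rule image_ideal_subset_if_indicators_null[OF \<sigma> Ii Ji])
    fix S :: "nat set" assume S: "indicator S \<in> c0_ideal I \<inter> l_infty"
    then have S': "indicator S \<in> c_ideal I \<inter> l_infty"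
      using c0_c by blast
    then obtain \<eta> where \<eta>: "ideal_converges_to J (perm_seq \<sigma> (indicator S)) \<eta>"
      using P6 by (auto simp: ideal_regular_def maps_into_def c_ideal_def)
    have "\<eta> = ideal_lim I (indicator S)"
      using P6 S' ideal_lim_eqI[OF assms(3) \<eta>] by (simp add: ideal_regular_def)
    also have "\<dots> = 0"
      using S ideal_lim_eqI[OF assms(2)] by (simp add: c0_ideal_def)
    finally show "ideal_converges_to J (perm_seq \<sigma> (indicator S)) 0"
      using \<eta> by simp
  qed
  have P7_P5: ?P5 if P7: ?P7
    using P7 by (intro image_ideal_subset_if_indicators_null[OF \<sigma> Ii Ji])
      (auto simp: maps_into_def c0_ideal_def)
  have "?P1 = ?P5" "?P2 = ?P5" "?P3 = ?P5" "?P4 = ?P5" "?P6 = ?P5" "?P7 = ?P5"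
    using fwd P4_P5 P2_P4 P3_P4 P6_P5 P7_P5 by argo+
  then have all: "\<forall>P\<in>set ?Ps. P = ?P5"
    by simp
  show ?thesis
    unfolding Let_def
  proof (intro conjI allI impI)
    show "\<forall>P\<in>set ?Ps. \<forall>Q\<in>set ?Ps. P \<longleftrightarrow> Q"
      using all by blast
  next
    fix g h :: "nat \<Rightarrow> real"
    assume *: "density_function g \<and> density_function h \<and>
           I = simple_density_ideal g \<and> J = simple_density_ideal h \<and>
           (\<forall>\<alpha>::real. \<alpha> > 1 \<longrightarrow>
              limsup (\<lambda>n. ereal (real n / g n)) < \<infinity> \<and>
              limsup (\<lambda>n. ereal (g (nat \<lfloor>\<alpha> * real n\<rfloor>) / h n)) < \<infinity>)"
    \<comment> \<open>This bound does not involve \<open>\<alpha>\<close>, so any single value above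
      1 yields it.\<close>
    have "limsup (\<lambda>n. ereal (real n / g n)) < \<infinity>"
      using * by (meson one_less_numeral_iff semiring_norm(76))
    then have "?P5 \<longleftrightarrow> \<not> ideal_limit_point J (sigma_hat \<sigma>) 0"
      using * image_density_ideal_subset_iff[OF \<sigma>, of g h] by blast
    then show "\<forall>P\<in>set ?Ps. P \<longleftrightarrow> \<not> ideal_limit_point J (sigma_hat \<sigma>) 0"
      using all by blast
  qed
qed

end
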